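(* For an integer $k\ge 1$ let $F(k;m_1)$ denote the number of $\alpha\in\mathcal{DDP}_k$ with $f(\alpha)=1$, that is, with exactly one fixed point. Then for all $n\geq 1$, $$F(2n;m_1)=2^{n+1}-2\quad\text{and}\quad F(2n-1;m_1)=3\cdot 2^{n-1}-2.$$
   Context: $X_k=\{1,2,\ldots,k\}$ and $\mathcal{I}_k$ is the symmetric inverse semigroup of all partial one-to-one maps of $X_k$ (including the empty map), with maps written on the right of their arguments. A map $\alpha\in\mathcal{I}_k$ is a partial isometry if $|x-y|=|x\alpha-y\alpha|$ for all $x,y\in\operatorname{Dom}\alpha$; it is order-decreasing if $x\alpha\leq x$ for all $x\in\operatorname{Dom}\alpha$. $\mathcal{DDP}_k$ is the semigroup of all order-decreasing partial isometries of $X_k$. The fix of $\alpha$ is $f(\alpha)=|\{x\in\operatorname{Dom}\alpha: x\alpha=x\}|$. *)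

theory Defs
  imports Main
begin

definition X :: "nat \<Rightarrow> nat set" where
  "X k = {1..k}"

text \<open>A partial map of \<open>X k\<close> is a map \<open>\<alpha> :: nat \<rightharpoonup> nat\<close> with domain and range inside \<open>X k\<close>;
  it is \<open>None\<close> outside its domain, so that distinct partial maps are distinct functions.\<close>

definition sym_inv :: "nat \<Rightarrow> (nat \<rightharpoonup> nat) set" where
  "sym_inv k = {\<alpha>. dom \<alpha> \<subseteq> X k \<and> ran \<alpha> \<subseteq> X k \<and> inj_on \<alpha> (dom \<alpha>)}"

definition partial_isometry :: "(nat \<rightharpoonup> nat) \<Rightarrow> bool" where
  "partial_isometry \<alpha> \<longleftrightarrow>
     (\<forall>x\<in>dom \<alpha>. \<forall>y\<in>dom \<alpha>. \<bar>int x - int y\<bar> = \<bar>int (the (\<alpha> x)) - int (the (\<alpha> y))\<bar>)"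

definition order_decreasing :: "(nat \<rightharpoonup> nat) \<Rightarrow> bool" where
  "order_decreasing \<alpha> \<longleftrightarrow> (\<forall>x\<in>dom \<alpha>. the (\<alpha> x) \<le> x)"

definition DDP :: "nat \<Rightarrow> (nat \<rightharpoonup> nat) set" where
  "DDP k = {\<alpha> \<in> sym_inv k. partial_isometry \<alpha> \<and> order_decreasing \<alpha>}"

definition fix_count :: "(nat \<rightharpoonup> nat) \<Rightarrow> nat" where
  "fix_count \<alpha> = card {x \<in> dom \<alpha>. the (\<alpha> x) = x}"

text \<open>\<open>F k m\<close> is the number of elements of \<open>DDP k\<close> with exactly \<open>m\<close> fixed points. The set counted
  is finite, since \<open>sym_inv k\<close> is.\<close>

definition F :: "nat \<Rightarrow> nat \<Rightarrow> nat" where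
  "F k m = card {\<alpha> \<in> DDP k. fix_count \<alpha> = m}"

end

theory Submission
  imports Defs
begin

text \<open>
  Let \<open>\<alpha>\<close> be an order-decreasing partial isometry with a single fixed point \<open>a\<close>. Any other point
  \<open>x\<close> of its domain keeps its distance to \<open>a\<close> but moves, so it goes to its mirror image
  \<open>2a - x\<close>; since maps decrease, \<open>x\<close> lies above \<open>a\<close>. Hence \<open>\<alpha>\<close> is the reflection about \<open>a\<close>
  restricted to \<open>insert a S\<close>, where \<open>S\<close> is a set of points above \<open>a\<close> that are at most \<open>k\<close> and whose
  mirror images are at least \<open>1\<close>. Conversely every such pair \<open>(a, S)\<close> gives a map of the required
  kind (\<open>one_fixed_point_eq_reflections\<close>), and the pair can be read off from the map
  (\<open>inj_on_reflection\<close>). There are \<open>min (k - a) (a - 1)\<close> admissible points for \<open>S\<close>, so the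
  number of maps is the sum of \<open>2 ^ min (k - a) (a - 1)\<close> over \<open>a\<close>. Passing from \<open>k\<close> to \<open>k + 2\<close>
  raises every exponent by one and adds a term \<open>1\<close> at either end, that is, it takes the sum \<open>s\<close>
  to \<open>2 * s + 2\<close> (\<open>F_one_add_two\<close>). Both closed forms follow from the cases \<open>k = 1\<close> and
  \<open>k = 2\<close>.
\<close>

definition reflection :: "nat \<Rightarrow> nat set \<Rightarrow> nat \<rightharpoonup> nat" where
  "reflection a S = (\<lambda>x. if x \<in> insert a S then Some (2 * a - x) else None)"

definition reflectable :: "nat \<Rightarrow> nat \<Rightarrow> nat set" where
  "reflectable k a = {a<..min k (2 * a - 1)}"

lemma dom_reflection: "dom (reflection a S) = insert a S"
  by (auto simp: reflection_def split: if_splits)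

lemma the_reflection: "x \<in> insert a S \<Longrightarrow> the (reflection a S x) = 2 * a - x"
  by (auto simp: reflection_def)

lemma fixed_points_reflection:
  assumes "S \<subseteq> reflectable k a"
  shows "{x \<in> dom (reflection a S). the (reflection a S x) = x} = {a}"
proof -
  have "the (reflection a S x) = x \<longleftrightarrow> x = a" if "x \<in> insert a S" for x
    unfolding the_reflection[OF that] using that assms by (auto simp: reflectable_def)
  then show ?thesis unfolding dom_reflection by blast
qed

lemma reflection_in_DDP:
  assumes a: "a \<in> {1..k}" and S: "S \<subseteq> reflectable k a"
  shows "reflection a S \<in> DDP k"
proof -
  have bounds: "a \<le> x \<and> x \<le> k \<and> x \<le> 2 * a - 1" if "x \<in> insert a S" for x
    using that a S by (auto simp: reflectable_def)
  have "dom (reflection a S) \<subseteq> X k"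
  proof
    fix x assume "x \<in> dom (reflection a S)"
    then have "x \<in> insert a S" by (simp add: dom_reflection)
    then show "x \<in> X k" using bounds[of x] a by (simp add: X_def)
  qed
  moreover have "ran (reflection a S) \<subseteq> X k"
  proof
    fix y assume "y \<in> ran (reflection a S)"
    then obtain x where x: "x \<in> insert a S" "y = 2 * a - x"
      by (auto simp: ran_def reflection_def split: if_splits)
    show "y \<in> X k" using bounds[OF x(1)] x(2) a by (auto simp: X_def)
  qed
  moreover have "inj_on (reflection a S) (dom (reflection a S))"
  proof (rule inj_onI)
    fix x y
    assume "x \<in> dom (reflection a S)" "y \<in> dom (reflection a S)"
      and eq: "reflection a S x = reflection a S y"
    then have xy: "x \<in> insert a S" "y \<in> insert a S" by (simp_all add: dom_reflection)
    then have "2 * a - x = 2 * a - y" using eq by (simp add: reflection_def split: if_splits)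
    then show "x = y" using bounds[OF xy(1)] bounds[OF xy(2)] a by arith
  qed
  moreover have "partial_isometry (reflection a S)"
    unfolding partial_isometry_def dom_reflection
  proof (intro ballI)
    fix x y assume x: "x \<in> insert a S" and y: "y \<in> insert a S"
    show "\<bar>int x - int y\<bar> = \<bar>int (the (reflection a S x)) - int (the (reflection a S y))\<bar>"
      unfolding the_reflection[OF x] the_reflection[OF y]
      using bounds[OF x] bounds[OF y] by arith
  qed
  moreover have "order_decreasing (reflection a S)"
    unfolding order_decreasing_def dom_reflection
  proof
    fix x assume x: "x \<in> insert a S"
    show "the (reflection a S x) \<le> x"
      unfolding the_reflection[OF x] using bounds[OF x] by arith
  qed
  ultimately show ?thesis by (simp add: DDP_def sym_inv_def)
qed

text \<open>
  The image of \<open>x\<close> is at distance \<open>|x - a|\<close> from \<open>a\<close>, which leaves only \<open>x\<close> itself and the mirror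
  image; the former is excluded because \<open>x\<close> moves, the latter exceeds \<open>x\<close> if \<open>x < a\<close>.
\<close>

lemma moved_point_reflected:
  assumes "\<alpha> \<in> DDP k" and a: "a \<in> dom \<alpha>" "the (\<alpha> a) = a"
    and x: "x \<in> dom \<alpha>" "the (\<alpha> x) \<noteq> x"
  shows "x \<in> reflectable k a \<and> the (\<alpha> x) = 2 * a - x"
proof -
  have "partial_isometry \<alpha>" using assms(1) by (simp add: DDP_def)
  then have "\<bar>int x - int a\<bar> = \<bar>int (the (\<alpha> x)) - int a\<bar>"
    using a x(1) unfolding partial_isometry_def by metis
  moreover have "the (\<alpha> x) \<le> x"
    using assms by (simp add: DDP_def order_decreasing_def)
  moreover have "x \<in> X k" "the (\<alpha> x) \<in> X k"
    using assms(1) x(1) by (auto simp: DDP_def sym_inv_def intro: ranI)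
  ultimately show ?thesis
    using x(2) by (auto simp: reflectable_def X_def)
qed

lemma one_fixed_point_eq_reflections:
  "{\<alpha> \<in> DDP k. fix_count \<alpha> = 1} =
    (\<lambda>(a, S). reflection a S) ` (SIGMA a:{1..k}. Pow (reflectable k a))" (is "?L = ?R")
proof
  show "?R \<subseteq> ?L"
  proof (clarify, intro conjI)
    fix a S assume "a \<in> {1..k}" and S: "S \<subseteq> reflectable k a"
    then show "reflection a S \<in> DDP k" by (rule reflection_in_DDP)
    show "fix_count (reflection a S) = 1"
      unfolding fix_count_def fixed_points_reflection[OF S] by simp
  qed
next
  show "?L \<subseteq> ?R"
  proof
    fix \<alpha> assume "\<alpha> \<in> ?L"
    then have \<alpha>: "\<alpha> \<in> DDP k" and "card {x \<in> dom \<alpha>. the (\<alpha> x) = x} = 1"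
      by (simp_all add: fix_count_def)
    then obtain a where fixed: "{x \<in> dom \<alpha>. the (\<alpha> x) = x} = {a}"
      by (auto simp: card_1_singleton_iff)
    then have a: "a \<in> dom \<alpha>" "the (\<alpha> a) = a" by auto
    have moved: "x \<in> reflectable k a \<and> the (\<alpha> x) = 2 * a - x" if "x \<in> dom \<alpha> - {a}" for x
      using moved_point_reflected[OF \<alpha> a, of x] that fixed by blast
    have "a \<in> {1..k}" using \<alpha> a(1) by (auto simp: DDP_def sym_inv_def X_def)
    moreover have "dom \<alpha> - {a} \<subseteq> reflectable k a" using moved by blast
    ultimately have "(a, dom \<alpha> - {a}) \<in> (SIGMA a:{1..k}. Pow (reflectable k a))" by simp
    then have "(\<lambda>(a, S). reflection a S) (a, dom \<alpha> - {a}) \<in> ?R" by (rule imageI)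
    moreover have "\<alpha> = reflection a (dom \<alpha> - {a})"
    proof
      fix x
      show "\<alpha> x = reflection a (dom \<alpha> - {a}) x"
      proof (cases "x \<in> dom \<alpha>")
        case True
        then have "the (\<alpha> x) = 2 * a - x" using moved a(2) by (cases "x = a") auto
        then show ?thesis using True by (auto simp: reflection_def)
      next
        case False
        then show ?thesis using a(1) by (auto simp: reflection_def domIff)
      qed
    qed
    ultimately show "\<alpha> \<in> ?R" by (metis prod.case)
  qed
qed

lemma inj_on_reflection:
  "inj_on (\<lambda>(a, S). reflection a S) (SIGMA a:{1..k}. Pow (reflectable k a))"
proof (rule inj_onI, clarify)
  fix a S b T
  assume S: "S \<subseteq> reflectable k a" and T: "T \<subseteq> reflectable k b"
    and eq: "reflection a S = reflection b T"
  have "{a} = {b}"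
    using fixed_points_reflection[OF S] fixed_points_reflection[OF T] unfolding eq by (rule trans[OF sym])
  moreover have "insert a S = insert b T"
    unfolding dom_reflection[symmetric] eq ..
  moreover have "a \<notin> S" "b \<notin> T" using S T by (auto simp: reflectable_def)
  ultimately show "a = b \<and> S = T" by (metis insert_ident singleton_inject)
qed

lemma F_one_eq_sum: "F k 1 = (\<Sum>a = 1..k. 2 ^ min (k - a) (a - 1))"
proof -
  have "F k 1 = card (SIGMA a:{1..k}. Pow (reflectable k a))"
    unfolding F_def one_fixed_point_eq_reflections by (rule card_image[OF inj_on_reflection])
  also have "\<dots> = (\<Sum>a = 1..k. card (Pow (reflectable k a)))"
    by (rule card_SigmaI) (auto simp: reflectable_def)
  also have "\<dots> = (\<Sum>a = 1..k. 2 ^ min (k - a) (a - 1))"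
  proof (rule sum.cong[OF refl])
    fix a assume "a \<in> {1..k}"
    then have "min k (2 * a - 1) - a = min (k - a) (a - 1)" by auto
    then show "card (Pow (reflectable k a)) = 2 ^ min (k - a) (a - 1)"
      by (simp add: reflectable_def card_Pow)
  qed
  finally show ?thesis .
qed

text \<open>
  Shifting the fixed point by one leaves room for one more reflectable point; only the two extreme
  fixed points \<open>1\<close> and \<open>k + 2\<close>, which admit none, are not obtained by the shift.
\<close>

lemma F_one_add_two: "F (k + 2) 1 = 2 * F k 1 + 2"
proof -
  let ?e = "\<lambda>a. 2 ^ min (k + 2 - a) (a - 1) :: nat"
  have "F (k + 2) 1 = (\<Sum>a = 1..Suc (Suc k). ?e a)"
    unfolding F_one_eq_sum by simp
  also have "\<dots> = (\<Sum>a = 1..Suc k. ?e a) + ?e (Suc (Suc k))"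
    by simp
  also have "(\<Sum>a = 1..Suc k. ?e a) = ?e 1 + (\<Sum>a = Suc 1..Suc k. ?e a)"
    by (rule sum.atLeast_Suc_atMost) simp
  also have "(\<Sum>a = Suc 1..Suc k. ?e a) = (\<Sum>b = 1..k. ?e (Suc b))"
    by (rule sum.shift_bounds_cl_Suc_ivl)
  also have "\<dots> = (\<Sum>b = 1..k. 2 * 2 ^ min (k - b) (b - 1))"
  proof (rule sum.cong[OF refl])
    fix b assume "b \<in> {1..k}"
    then have "min (k + 2 - Suc b) (Suc b - 1) = Suc (min (k - b) (b - 1))" by auto
    then show "?e (Suc b) = 2 * 2 ^ min (k - b) (b - 1)" by (simp only: power_Suc)
  qed
  also have "\<dots> = 2 * F k 1" unfolding F_one_eq_sum by (rule sum_distrib_left[symmetric])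
  finally show ?thesis by simp
qed

theorem proposition2p19:
  fixes n :: nat
  assumes "n \<ge> 1"
  shows "int (F (2 * n) 1) = 2 ^ (n + 1) - 2 \<and> int (F (2 * n - 1) 1) = 3 * 2 ^ (n - 1) - 2"
  using assms
proof (induction n rule: dec_induct)
  case base
  have "{1..2::nat} = {1, 2}" by auto
  then show ?case unfolding F_one_eq_sum by simp
next
  case (step n)
  have "2 * Suc n = 2 * n + 2" "2 * Suc n - 1 = (2 * n - 1) + 2" using step.hyps by simp_all
  moreover have "(2::int) ^ n = 2 * 2 ^ (n - 1)"
    using step.hyps by (cases n) simp_all
  ultimately show ?case
    using step.IH by (simp only: F_one_add_two) simp
qed

end
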